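(* For $n\ge 1$, the number of subsets $S\subseteq\{0,1,\dots,n-1\}$ with $|S+S|=|S-S|$ is at least $(2\times10^{-5})\,2^n$.
   Context: $S+S=\{s_1+s_2: s_1,s_2\in S\}$ and $S-S=\{s_1-s_2: s_1,s_2\in S\}$. *)

theory Defs
  imports Complex_Main "HOL-Library.Set_Algebras"
begin

text \<open>
  Sumsets are written with the pointwise \<open>+\<close> on sets from \<^theory>\<open>HOL-Library.Set_Algebras\<close>.
  On sets \<open>-\<close> is the set-theoretic difference, so the pointwise difference set needs its own name.
\<close>

definition diffset :: "int set \<Rightarrow> int set \<Rightarrow> int set" where
  "diffset A B = {a - b | a b. a \<in> A \<and> b \<in> B}"

end

theory Submission imports Defs begin

text \<open>
  Fix full fringes of length \<open>m = 5\<close> at both ends of \<open>[0, n)\<close> and choose the middle of \<open>S\<close> freely.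
  The fringes already produce all extreme and all central sums, all very small and all very large
  differences. Any other value is missing only if a block of \<open>m\<close> middle
  elements (its partners in a fringe) is absent and each of many disjoint pairs of middle elements
  is not contained in \<open>S\<close>, which has density at most \<open>2\<^sup>-\<^sup>m (3/4)\<^sup>t\<close>. The geometric series add up to at most
  \<open>24 / 2\<^sup>5 = 3/4\<close>, so at least a quarter of the choices give \<open>S + S = [0, 2n - 2]\<close> and
  \<open>S - S = [-(n - 1), n - 1]\<close>, two sets of equal size.
  These make up at least \<open>2\<^sup>-\<^sup>1\<^sup>2\<close> of all subsets. For \<open>n < 15\<close> the empty set suffices, since \<open>2\<^sup>n < 50000\<close>.
\<close>

section \<open>Counting subsets that miss a block and contain no pair from a disjoint family\<close>

definition avoiding :: "'a set \<Rightarrow> 'a set \<Rightarrow> 'a set \<Rightarrow> ('a \<Rightarrow> 'a) \<Rightarrow> 'a set set" where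
  "avoiding M A X g = {T. T \<subseteq> M \<and> T \<inter> A = {} \<and> (\<forall>x\<in>X. \<not> (x \<in> T \<and> g x \<in> T))}"

lemma finite_avoiding: "finite M \<Longrightarrow> finite (avoiding M A X g)"
  by (rule finite_subset[of _ "Pow M"]) (auto simp: avoiding_def)

text \<open>The hypotheses make \<open>A\<close> and all pairs \<open>{x, g x}\<close> disjoint, so
  the constraints are independent: each point of \<open>A\<close> allows one of two states, each
  pair three of four. The induction removes one pair at a time from \<open>M\<close>.\<close>

lemma card_avoiding_le:
  assumes "finite X" "finite M" "A \<subseteq> M" "X \<subseteq> M" "g ` X \<subseteq> M" "inj_on g X"
    and "A \<inter> X = {}" "A \<inter> g ` X = {}" "X \<inter> g ` X = {}"
  shows "real (card (avoiding M A X g)) \<le> 2 ^ card M * ((1/2) ^ card A * (3/4) ^ card X)"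
  using assms
proof (induction X arbitrary: M rule: finite_induct)
  case empty
  have "avoiding M A {} g = Pow (M - A)"
    by (auto simp: avoiding_def)
  moreover have "card M = card (M - A) + card A"
    using empty by (simp add: card_Diff_subset card_mono finite_subset)
  ultimately show ?case
    using empty.prems(1) by (simp add: card_Pow power_divide power_add)
next
  case (insert x X)
  let ?P = "{x, g x}" and ?M = "M - {x, g x}"
  have x: "x \<in> M" "g x \<in> M" "g x \<noteq> x"
    using insert.prems by auto
  then have cardM: "card M = card ?M + 2"
    using insert.prems(1) card_Diff_subset[of ?P M] card_mono[of M ?P] by auto
  have IH: "real (card (avoiding ?M A X g)) \<le> 2 ^ card ?M * ((1/2) ^ card A * (3/4) ^ card X)"
    using insert.prems insert.hyps by (intro insert.IH) (auto simp: inj_on_def)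
  \<comment> \<open>Split \<open>T\<close> into its trace on the new pair and the rest. The trace is
    not the whole pair, which leaves three possibilities.\<close>
  define \<phi> where "\<phi> T = (T \<inter> ?P, T - ?P)" for T
  have inj: "inj_on \<phi> (avoiding M A (insert x X) g)"
  proof (rule inj_on_inverseI[where g = "\<lambda>p. fst p \<union> snd p"])
    show "fst (\<phi> T) \<union> snd (\<phi> T) = T" for T
      unfolding \<phi>_def by auto
  qed
  have "\<phi> ` avoiding M A (insert x X) g \<subseteq> {{}, {x}, {g x}} \<times> avoiding ?M A X g"
    by (auto simp: \<phi>_def avoiding_def)
  then have "card (\<phi> ` avoiding M A (insert x X) g) \<le> card ({{}, {x}, {g x}} \<times> avoiding ?M A X g)"
    using insert.prems(1) by (intro card_mono) (auto simp: finite_avoiding)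
  then have "card (avoiding M A (insert x X) g) \<le> 3 * card (avoiding ?M A X g)"
    using x(3) by (simp add: card_image[OF inj] card_cartesian_product)
  then have "real (card (avoiding M A (insert x X) g)) \<le> 3 * real (card (avoiding ?M A X g))"
    by linarith
  also have "\<dots> \<le> 3 * (2 ^ card ?M * ((1/2) ^ card A * (3/4) ^ card X))"
    using IH by simp
  also have "\<dots> = 2 ^ card M * ((1/2) ^ card A * (3/4) ^ card (insert x X))"
    using insert.hyps by (simp add: cardM power_add)
  finally show ?case .
qed

section \<open>Bounds for the geometric series\<close>

lemma sum_power_three_quarters_le: "(\<Sum>j\<le>K. (3/4::real) ^ j) \<le> 4"
proof -
  have "(\<Sum>j\<le>K. (3/4::real) ^ j) = 4 - 3 * (3/4) ^ K"
    by (induction K) auto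
  then show ?thesis by simp
qed

lemma sum_power_three_quarters_div2_le: "(\<Sum>j\<le>K. (3/4::real) ^ (j div 2)) \<le> 8"
proof -
  \<comment> \<open>Extending the range to \<open>2 * Suc K\<close> terms makes each exponent up to
    \<open>K\<close> occur exactly twice.\<close>
  have "(\<Sum>j\<le>K. (3/4::real) ^ (j div 2)) \<le> (\<Sum>j<2 * Suc K. (3/4::real) ^ (j div 2))"
    by (rule sum_mono2) auto
  also have "\<dots> = 2 * (\<Sum>j\<le>K. (3/4::real) ^ j)"
    by (induction K) auto
  also have "\<dots> \<le> 8"
    using sum_power_three_quarters_le[of K] by simp
  finally show ?thesis .
qed

text \<open>The power of a minimum is at most the sum of both powers, and reflecting j to K - j
  turns the second series into the first.\<close>

lemma sum_power_three_quarters_min_le: "(\<Sum>j\<le>K. (3/4::real) ^ min j (K - j)) \<le> 8"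
proof -
  have "(\<Sum>j\<le>K. (3/4::real) ^ min j (K - j)) \<le> (\<Sum>j\<le>K. (3/4) ^ j + (3/4) ^ (K - j))"
    by (rule sum_mono) (auto simp: min_def)
  also have "\<dots> = 2 * (\<Sum>j\<le>K. (3/4::real) ^ j)"
    using sum.nat_diff_reindex[of "\<lambda>j. (3/4::real) ^ j" "Suc K"]
    by (simp add: sum.distrib lessThan_Suc_atMost)
  also have "\<dots> \<le> 8"
    using sum_power_three_quarters_le[of K] by simp
  finally show ?thesis .
qed

section \<open>Fringed sets, and the middles that miss a given sum or difference\<close>

definition fringed :: "nat \<Rightarrow> nat \<Rightarrow> int set \<Rightarrow> int set" where
  "fringed m n T = {0..<int m} \<union> T \<union> {int n - int m..<int n}"

abbreviation middle :: "nat \<Rightarrow> nat \<Rightarrow> int set" where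
  "middle m n \<equiv> {int m..<int n - int m}"

definition no_sum :: "nat \<Rightarrow> nat \<Rightarrow> int \<Rightarrow> int set set" where
  "no_sum m n k = {T. T \<subseteq> middle m n \<and> k \<notin> fringed m n T + fringed m n T}"

definition no_diff :: "nat \<Rightarrow> nat \<Rightarrow> int \<Rightarrow> int set set" where
  "no_diff m n d = {T. T \<subseteq> middle m n \<and> d \<notin> diffset (fringed m n T) (fringed m n T)}"

lemma mem_sumI: "a \<in> A \<Longrightarrow> k - a \<in> A \<Longrightarrow> (k::int) \<in> A + A"
  by (metis set_plus_intro add_diff_cancel_left' diff_add_cancel add.commute)

lemma mem_diffsetI: "a \<in> A \<Longrightarrow> a + d \<in> A \<Longrightarrow> d \<in> diffset A A"
  unfolding diffset_def by (smt (verit) mem_Collect_eq add_diff_cancel_left')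

text \<open>Missing k excludes the block \<open>?A\<close> of partners k - f of the left fringe
  elements f; the bound on j keeps this block in the middle. Below it lie the j points from m to k -
  m = m + j - 1, on which x to k - x is a reflection; their lower half \<open>?X\<close> yields j
  div 2 disjoint pairs.\<close>

lemma card_no_sum_left:
  assumes "m > 0" "3 * m + j \<le> n"
  shows "real (card (no_sum m n (2 * int m - 1 + int j)))
           \<le> 2 ^ (n - 2 * m) * ((1/2) ^ m * (3/4) ^ (j div 2))"
proof -
  define k where "k = 2 * int m - 1 + int j"
  define t where "t = int (j div 2)"
  have t: "2 * t \<le> int j" "0 \<le> t" by (auto simp: t_def)
  let ?A = "{k - int m + 1..k}" and ?X = "{int m..<int m + t}"
  have "no_sum m n k \<subseteq> avoiding (middle m n) ?A ?X (\<lambda>x. k - x)"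
  proof
    fix T assume T: "T \<in> no_sum m n k"
    have "a \<notin> T" if "a \<in> ?A" for a
      using that T mem_sumI[of a "fringed m n T" k] by (auto simp: no_sum_def fringed_def)
    moreover have "\<not> (x \<in> T \<and> k - x \<in> T)" for x
      using T mem_sumI[of x "fringed m n T" k] by (auto simp: no_sum_def fringed_def)
    ultimately show "T \<in> avoiding (middle m n) ?A ?X (\<lambda>x. k - x)"
      using T by (auto simp: avoiding_def no_sum_def)
  qed
  then have "card (no_sum m n k) \<le> card (avoiding (middle m n) ?A ?X (\<lambda>x. k - x))"
    by (intro card_mono finite_avoiding) auto
  also have "real \<dots> \<le> 2 ^ card (middle m n) * ((1/2) ^ card ?A * (3/4) ^ card ?X)"
    using assms t by (intro card_avoiding_le) (auto simp: k_def inj_on_def)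
  finally show ?thesis
    using assms by (simp add: k_def t_def nat_diff_distrib' nat_mult_distrib)
qed

text \<open>Mirror image of \<open>card_no_sum_left\<close> under x to n - 1 - x, which sends k to
  2n - 2 - k; the block now consists of the partners of the right fringe.\<close>

lemma card_no_sum_right:
  assumes "m > 0" "3 * m + j \<le> n"
  shows "real (card (no_sum m n (2 * int n - 1 - 2 * int m - int j)))
           \<le> 2 ^ (n - 2 * m) * ((1/2) ^ m * (3/4) ^ (j div 2))"
proof -
  define k where "k = 2 * int n - 1 - 2 * int m - int j"
  define t where "t = int (j div 2)"
  have t: "2 * t \<le> int j" "0 \<le> t" by (auto simp: t_def)
  let ?A = "{k - int n + 1..k - int n + int m}" and ?X = "{int n - int m - t..<int n - int m}"
  have "no_sum m n k \<subseteq> avoiding (middle m n) ?A ?X (\<lambda>x. k - x)"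
  proof
    fix T assume T: "T \<in> no_sum m n k"
    have "a \<notin> T" if "a \<in> ?A" for a
      using that T mem_sumI[of a "fringed m n T" k] by (auto simp: no_sum_def fringed_def)
    moreover have "\<not> (x \<in> T \<and> k - x \<in> T)" for x
      using T mem_sumI[of x "fringed m n T" k] by (auto simp: no_sum_def fringed_def)
    ultimately show "T \<in> avoiding (middle m n) ?A ?X (\<lambda>x. k - x)"
      using T by (auto simp: avoiding_def no_sum_def)
  qed
  then have "card (no_sum m n k) \<le> card (avoiding (middle m n) ?A ?X (\<lambda>x. k - x))"
    by (intro card_mono finite_avoiding) auto
  also have "real \<dots> \<le> 2 ^ card (middle m n) * ((1/2) ^ card ?A * (3/4) ^ card ?X)"
    using assms t by (intro card_avoiding_le) (auto simp: k_def inj_on_def)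
  finally show ?thesis
    using assms by (simp add: k_def t_def nat_diff_distrib' nat_mult_distrib)
qed

text \<open>Here the block is the left fringe shifted by d, and the pairs are (x, x + d). Their
  number t is limited twice: t \<le> j keeps \<open>?X\<close> below the block, and t \<le> n - 3m -
  j keeps the shifted copy of \<open>?X\<close> below the right fringe.\<close>

lemma card_no_diff:
  assumes "3 * m + j \<le> n"
  shows "real (card (no_diff m n (int m + int j)))
           \<le> 2 ^ (n - 2 * m) * ((1/2) ^ m * (3/4) ^ min j (n - 3 * m - j))"
proof -
  define d where "d = int m + int j"
  define t where "t = int (min j (n - 3 * m - j))"
  have t: "t \<le> int j" "t \<le> int n - 3 * int m - int j" "0 \<le> t"
    using assms by (auto simp: t_def)
  let ?A = "{d..<d + int m}" and ?X = "{int m..<int m + t}"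
  have "no_diff m n d \<subseteq> avoiding (middle m n) ?A ?X (\<lambda>x. x + d)"
  proof
    fix T assume T: "T \<in> no_diff m n d"
    have "a \<notin> T" if "a \<in> ?A" for a
      using that T mem_diffsetI[of "a - d" "fringed m n T" d] by (auto simp: no_diff_def fringed_def)
    moreover have "\<not> (x \<in> T \<and> x + d \<in> T)" for x
      using T mem_diffsetI[of x "fringed m n T" d] by (auto simp: no_diff_def fringed_def)
    ultimately show "T \<in> avoiding (middle m n) ?A ?X (\<lambda>x. x + d)"
      using T by (auto simp: avoiding_def no_diff_def)
  qed
  then have "card (no_diff m n d) \<le> card (avoiding (middle m n) ?A ?X (\<lambda>x. x + d))"
    by (intro card_mono finite_avoiding) auto
  also have "real \<dots> \<le> 2 ^ card (middle m n) * ((1/2) ^ card ?A * (3/4) ^ card ?X)"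
    using assms t by (intro card_avoiding_le) (auto simp: d_def inj_on_def)
  finally show ?thesis
    using assms by (simp add: d_def t_def nat_diff_distrib' nat_mult_distrib)
qed

text \<open>As j varies, the three families cover exactly the values left open by the fringes: sums
  from 2m - 1 to n - m - 1 and from n + m - 1 to 2n - 2m - 1, and differences from m to n -
  2m.\<close>

definition exceptional :: "nat \<Rightarrow> nat \<Rightarrow> int set set" where
  "exceptional m n = (\<Union>j\<le>n - 3 * m. no_sum m n (2 * int m - 1 + int j)
     \<union> no_sum m n (2 * int n - 1 - 2 * int m - int j) \<union> no_diff m n (int m + int j))"

text \<open>Union bound over j; each of the three families contributes a series of size at most 8,
  whence 24.\<close>

lemma card_exceptional:
  assumes "m > 0" "3 * m \<le> n"
  shows "real (card (exceptional m n)) \<le> 2 ^ (n - 2 * m) * (24 / 2 ^ m)"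
proof -
  let ?K = "n - 3 * m"
  let ?c = "2 ^ (n - 2 * m) * (1/2) ^ m :: real"
  let ?B = "\<lambda>j. no_sum m n (2 * int m - 1 + int j)
     \<union> no_sum m n (2 * int n - 1 - 2 * int m - int j) \<union> no_diff m n (int m + int j)"
  have "real (card (exceptional m n)) \<le> (\<Sum>j\<le>?K. real (card (?B j)))"
    unfolding exceptional_def of_nat_sum[symmetric] of_nat_le_iff by (rule card_UN_le) simp
  also have "\<dots> \<le> (\<Sum>j\<le>?K. ?c * ((3/4) ^ (j div 2) + (3/4) ^ (j div 2) + (3/4) ^ min j (?K - j)))"
  proof (rule sum_mono)
    fix j assume "j \<in> {..?K}"
    then have j: "3 * m + j \<le> n" using assms by auto
    have "card (?B j) \<le> card (no_sum m n (2 * int m - 1 + int j))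
        + card (no_sum m n (2 * int n - 1 - 2 * int m - int j)) + card (no_diff m n (int m + int j))"
      by (meson card_Un_le add_le_mono1 order_trans)
    then show "real (card (?B j)) \<le> ?c * ((3/4) ^ (j div 2) + (3/4) ^ (j div 2) + (3/4) ^ min j (?K - j))"
      using card_no_sum_left[OF assms(1) j] card_no_sum_right[OF assms(1) j] card_no_diff[OF j]
      by (simp add: algebra_simps)
  qed
  also have "\<dots> = ?c * ((\<Sum>j\<le>?K. (3/4) ^ (j div 2)) + (\<Sum>j\<le>?K. (3/4) ^ (j div 2))
      + (\<Sum>j\<le>?K. (3/4) ^ min j (?K - j)))"
    by (simp only: sum_distrib_left[symmetric] sum.distrib)
  also have "\<dots> \<le> ?c * 24"
    using sum_power_three_quarters_div2_le[of ?K] sum_power_three_quarters_min_le[of ?K]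
    by (intro mult_left_mono) auto
  finally show ?thesis
    by (simp add: power_divide)
qed

section \<open>Sumset and difference set for a middle that is not exceptional\<close>

lemma fringed_sumset:
  assumes "m > 0" "3 * m \<le> n" and T: "T \<subseteq> middle m n" "T \<notin> exceptional m n"
  shows "fringed m n T + fringed m n T = {0..2 * int n - 2}"
proof (rule antisym)
  let ?S = "fringed m n T"
  have sub: "?S \<subseteq> {0..int n - 1}"
    using assms by (auto simp: fringed_def)
  show "?S + ?S \<subseteq> {0..2 * int n - 2}"
  proof
    fix k assume "k \<in> ?S + ?S"
    then obtain a b where "k = a + b" "a \<in> ?S" "b \<in> ?S" by (rule set_plus_elim)
    then show "k \<in> {0..2 * int n - 2}" using subsetD[OF sub, of a] subsetD[OF sub, of b] by simp
  qed
  have fringe: "x \<in> ?S" if "0 \<le> x \<and> x < int m \<or> int n - int m \<le> x \<and> x < int n" for x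
    using that by (auto simp: fringed_def)
  show "{0..2 * int n - 2} \<subseteq> ?S + ?S"
  proof
    fix k assume k: "k \<in> {0..2 * int n - 2}"
    \<comment> \<open>The first, third and fifth ranges are left + left, left + right and right +
      right fringe; the two gaps are where \<open>exceptional\<close> is needed.\<close>
    consider "k \<le> 2 * int m - 2" | "2 * int m - 1 \<le> k" "k \<le> int n - int m - 1"
      | "int n - int m \<le> k" "k \<le> int n + int m - 2"
      | "int n + int m - 1 \<le> k" "k \<le> 2 * int n - 2 * int m - 1" | "2 * int n - 2 * int m \<le> k"
      by linarith
    then show "k \<in> ?S + ?S"
    proof cases
      case 1
      then show ?thesis using k assms by (intro mem_sumI[of "min k (int m - 1)"] fringe) auto
    next
      case 2
      then obtain j where "j \<le> n - 3 * m" "k = 2 * int m - 1 + int j"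
        using assms that[of "nat (k - (2 * int m - 1))"] by auto
      then have "T \<notin> no_sum m n k"
        using T(2) by (auto simp: exceptional_def)
      then show ?thesis using T(1) by (auto simp: no_sum_def)
    next
      case 3
      \<comment> \<open>The witness is the least a \<ge> 0 with k - a \<le> n - 1; then a is in the
        left fringe and k - a in the right one.\<close>
      then show ?thesis using k assms by (intro mem_sumI[of "max 0 (k - int n + 1)"] fringe) auto
    next
      case 4
      then obtain j where "j \<le> n - 3 * m" "k = 2 * int n - 1 - 2 * int m - int j"
        using assms that[of "nat (2 * int n - 1 - 2 * int m - k)"] by auto
      then have "T \<notin> no_sum m n k"
        using T(2) by (auto simp: exceptional_def)
      then show ?thesis using T(1) by (auto simp: no_sum_def)
    next
      case 5
      then show ?thesis using k assms by (intro mem_sumI[of "max (int n - int m) (k - int n + 1)"] fringe) auto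
    qed
  qed
qed

lemma fringed_diffset:
  assumes "m > 0" "3 * m \<le> n" and T: "T \<subseteq> middle m n" "T \<notin> exceptional m n"
  shows "diffset (fringed m n T) (fringed m n T) = {1 - int n..int n - 1}"
proof (rule antisym)
  let ?S = "fringed m n T"
  have sub: "?S \<subseteq> {0..int n - 1}"
    using assms by (auto simp: fringed_def)
  show "diffset ?S ?S \<subseteq> {1 - int n..int n - 1}"
  proof
    fix d assume "d \<in> diffset ?S ?S"
    then obtain a b where "d = a - b" "a \<in> ?S" "b \<in> ?S" by (auto simp: diffset_def)
    then show "d \<in> {1 - int n..int n - 1}" using subsetD[OF sub, of a] subsetD[OF sub, of b] by simp
  qed
  have fringe: "x \<in> ?S" if "0 \<le> x \<and> x < int m \<or> int n - int m \<le> x \<and> x < int n" for x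
    using that by (auto simp: fringed_def)
  have nonneg: "d \<in> diffset ?S ?S" if d: "0 \<le> d" "d \<le> int n - 1" for d
  proof -
    \<comment> \<open>Small differences occur inside the left fringe, large ones between the two
      fringes. For the latter, the witness in case 3 is the least a \<ge> 0 with a + d in the right
      fringe.\<close>
    consider "d < int m" | "int m \<le> d" "d \<le> int n - 2 * int m" | "int n - 2 * int m < d"
      by linarith
    then show ?thesis
    proof cases
      case 1
      then show ?thesis using d assms by (intro mem_diffsetI[of 0] fringe) auto
    next
      case 2
      then obtain j where "j \<le> n - 3 * m" "d = int m + int j"
        using assms that[of "nat (d - int m)"] by auto
      then have "T \<notin> no_diff m n d"
        using T(2) by (auto simp: exceptional_def)
      then show ?thesis using T(1) by (auto simp: no_diff_def)
    next
      case 3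
      then show ?thesis using d assms
        by (intro mem_diffsetI[of "max 0 (int n - int m - d)"] fringe) auto
    qed
  qed
  show "{1 - int n..int n - 1} \<subseteq> diffset ?S ?S"
  proof
    fix d assume d: "d \<in> {1 - int n..int n - 1}"
    show "d \<in> diffset ?S ?S"
    \<comment> \<open>A difference set is symmetric about 0, so negative d reduce to
      \<open>nonneg\<close> by swapping a and b.\<close>
    proof (cases "0 \<le> d")
      case True
      then show ?thesis using d nonneg by simp
    next
      case False
      then have "- d \<in> diffset ?S ?S" using d nonneg[of "- d"] by simp
      then obtain a b where "a \<in> ?S" "b \<in> ?S" "- d = a - b"
        by (auto simp: diffset_def)
      then show ?thesis by (intro mem_diffsetI[of a]) (auto simp: algebra_simps)
    qed
  qed
qed

section \<open>Counting the sets with fringes of length 5\<close>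

theorem theorem16:
  fixes n :: nat
  assumes "n \<ge> 1"
  shows "real (card {S :: int set. S \<subseteq> {0..int n - 1} \<and> card (S + S) = card (diffset S S)})
           \<ge> (2 * 10 powi (-5)) * 2 ^ n"
proof -
  let ?F = "{S :: int set. S \<subseteq> {0..int n - 1} \<and> card (S + S) = card (diffset S S)}"
  have fin: "finite ?F"
    by (rule finite_subset[of _ "Pow {0..int n - 1}"]) auto
  have const: "2 * 10 powi (-5) = (1 / 50000 :: real)"
    by (simp add: power_int_def power_one_over)
  show ?thesis
  proof (cases "n < 15")
    case True
    have "{} \<in> ?F" by (auto simp: diffset_def set_plus_def)
    then have "1 \<le> real (card ?F)"
      using card_mono[OF fin, of "{{}}"] by simp
    moreover have "(2::real) ^ n \<le> 2 ^ 15"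
      using True by (intro power_increasing) auto
    ultimately show ?thesis by (simp add: const)
  next
    case False
    \<comment> \<open>The value 5 is the least m with 24 / 2 ^ m < 1, and the cutoff 15 is the
      requirement 3 * m \<le> n of the fringe lemmas.\<close>
    then have n: "3 * 5 \<le> n" by simp
    let ?G = "Pow (middle 5 n) - exceptional 5 n"
    \<comment> \<open>Distinct middles give distinct sets, since the middle is recovered by
      intersection.\<close>
    have inj: "inj_on (fringed 5 n) ?G"
    proof (rule inj_on_inverseI[where g = "\<lambda>S. S \<inter> middle 5 n"])
      show "fringed 5 n T \<inter> middle 5 n = T" if "T \<in> ?G" for T
        using that by (auto simp: fringed_def)
    qed
    have "fringed 5 n ` ?G \<subseteq> ?F"
    proof (clarify, intro conjI)
      fix T assume T: "T \<subseteq> middle 5 n" "T \<notin> exceptional 5 n"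
      show "fringed 5 n T \<subseteq> {0..int n - 1}"
        using T(1) n by (auto simp: fringed_def)
      show "card (fringed 5 n T + fringed 5 n T) = card (diffset (fringed 5 n T) (fringed 5 n T))"
        using fringed_sumset[OF _ n T] fringed_diffset[OF _ n T] by simp
    qed
    from card_mono[OF fin this] have G: "card ?G \<le> card ?F"
      by (simp only: card_image[OF inj])
    have sub: "exceptional 5 n \<subseteq> Pow (middle 5 n)"
      by (auto simp: exceptional_def no_sum_def no_diff_def)
    have "card ?G = card (Pow (middle 5 n)) - card (exceptional 5 n)"
      by (rule card_Diff_subset[OF finite_subset[OF sub] sub]) simp
    then have "real (card (Pow (middle 5 n))) - real (card (exceptional 5 n)) \<le> real (card ?F)"
      using G by linarith
    moreover have "real (card (Pow (middle 5 n))) = 2 ^ (n - 10)"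
      using n by (simp add: card_Pow nat_diff_distrib')
    moreover have "real (card (exceptional 5 n)) \<le> 2 ^ (n - 10) * (3 / 4)"
      using card_exceptional[OF _ n] by simp
    ultimately have "2 ^ (n - 10) / 4 \<le> real (card ?F)" by simp
    \<comment> \<open>The two fringes fix 10 positions; with the factor 1/4 this gives density
      1/4096, well above 1/50000.\<close>
    moreover have "(2::real) ^ n = 2 ^ (n - 10) * 2 ^ 10"
      using n power_add[of "2::real" "n - 10" 10] by simp
    ultimately show ?thesis by (simp add: const)
  qed
qed

end
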